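(* Let $G$ be a graph with four distinct vertices $1,2,3,4$ such that $\{1,4\}$, $\{2,3\}$ and $\{1,2\}$ are edges of $G$. Let $H$ be the graph with $V(H)=V(G)\sqcup\{a,b,c,d\}$ (four new vertices) and $$E(H)=\big(E(G)\setminus\{\{1,4\},\{2,3\}\}\big)\cup\{\{1,a\},\{a,b\},\{b,3\},\{2,c\},\{c,d\},\{d,4\},\{a,c\},\{b,d\}\}.$$ Then $\mathrm{Ind}(H)\simeq\Sigma(\mathrm{Ind}(G))$.
   Context: Graphs are finite and simple. The independence complex $\mathrm{Ind}(G)$ is the simplicial complex whose simplices are the independent vertex sets of $G$. $\Sigma$ denotes suspension and $\simeq$ homotopy equivalence of geometric realizations. *)

theory Defs
  imports "HOL-Analysis.Analysis" "HOL-Library.Ramsey"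
begin

definition finite_simple_graph :: "'a set \<Rightarrow> 'a set set \<Rightarrow> bool" where
  "finite_simple_graph V E \<longleftrightarrow> finite V \<and> E \<subseteq> [V]\<^bsup>2\<^esup>"

text \<open>The empty simplex belongs to the complex; it contributes no point to the realization.\<close>

definition independence_complex :: "'a set \<Rightarrow> 'a set set \<Rightarrow> 'a set set" where
  "independence_complex V E = {S. S \<subseteq> V \<and> indep S E}"

text \<open>
  Points are written in barycentric coordinates, extended by zero to the whole type.
  The topology is the one inherited from the product topology on functions; for a finite complex
  this is the Euclidean (equivalently, the weak) topology.
\<close>

definition geometric_realization :: "'a set set \<Rightarrow> ('a \<Rightarrow> real) topology" where
  "geometric_realization K =
     top_of_set {w. (\<forall>v. 0 \<le> w v) \<and> {v. w v \<noteq> 0} \<in> K \<and> (\<Sum>v | w v \<noteq> 0. w v) = 1}"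

text \<open>
  The unreduced suspension: the quotient of \<open>X \<times> [0,1]\<close> that collapses \<open>X \<times> {0}\<close> to one point
  and \<open>X \<times> {1}\<close> to another. Both poles are present also for empty \<open>X\<close>, whose suspension
  is therefore the 0-sphere.
\<close>

datatype 'a suspension_point = South | North | Level 'a real

definition suspension_proj :: "'a \<times> real \<Rightarrow> 'a suspension_point" where
  "suspension_proj = (\<lambda>(x, t). if t = 0 then South else if t = 1 then North else Level x t)"

definition suspension :: "'a topology \<Rightarrow> 'a suspension_point topology" where
  "suspension X = topology (\<lambda>U.
     U \<subseteq> {South, North} \<union> suspension_proj ` (topspace X \<times> {0..1}) \<and>
     openin (prod_topology X (top_of_set {0..1}))
       {p \<in> topspace X \<times> {0..1}. suspension_proj p \<in> U})"

lemma openin_suspension: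
  "openin (suspension X) U \<longleftrightarrow>
     U \<subseteq> {South, North} \<union> suspension_proj ` (topspace X \<times> {0..1}) \<and>
     openin (prod_topology X (top_of_set {0..1}))
       {p \<in> topspace X \<times> {0..1}. suspension_proj p \<in> U}"
proof -
  let ?Y = "prod_topology X (top_of_set {0..1::real})"
  let ?pre = "\<lambda>U. {p \<in> topspace X \<times> {0..1}. suspension_proj p \<in> U}"
  let ?open = "\<lambda>U. U \<subseteq> {South, North} \<union> suspension_proj ` (topspace X \<times> {0..1}) \<and> openin ?Y (?pre U)"
  have "istopology ?open"
    unfolding istopology_def
  proof (intro conjI allI impI)
    fix S T assume S: "?open S" and T: "?open T"
    have "?pre (S \<inter> T) = ?pre S \<inter> ?pre T" by blast
    moreover have "openin ?Y (?pre S \<inter> ?pre T)"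
      using S T openin_Int by blast
    ultimately show "openin ?Y (?pre (S \<inter> T))" by metis
    show "S \<inter> T \<subseteq> {South, North} \<union> suspension_proj ` (topspace X \<times> {0..1})"
      using S by blast
  next
    fix \<K> assume K: "\<forall>S\<in>\<K>. ?open S"
    have "?pre (\<Union>\<K>) = \<Union>(?pre ` \<K>)" by blast
    moreover have "openin ?Y (\<Union>(?pre ` \<K>))"
      using K by (intro openin_Union) blast
    ultimately show "openin ?Y (?pre (\<Union>\<K>))" by metis
    show "\<Union>\<K> \<subseteq> {South, North} \<union> suspension_proj ` (topspace X \<times> {0..1})"
      using K by blast
  qed
  then show ?thesis
    unfolding suspension_def by (simp add: topology_inverse')
qed

lemma topspace_suspension:
  "topspace (suspension X) = {South, North} \<union> suspension_proj ` (topspace X \<times> {0..1})"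
proof -
  let ?T = "{South, North} \<union> suspension_proj ` (topspace X \<times> {0..1})"
  have "{p \<in> topspace X \<times> {0..1::real}. suspension_proj p \<in> ?T}
      = topspace (prod_topology X (top_of_set {0..1}))" by auto
  then have "openin (suspension X) ?T"
    unfolding openin_suspension by (metis openin_topspace subset_refl)
  then have "?T \<subseteq> topspace (suspension X)" by (rule openin_subset)
  moreover have "topspace (suspension X) \<subseteq> ?T"
    using openin_topspace[of "suspension X"] unfolding openin_suspension by (rule conjunct1)
  ultimately show ?thesis by (rule subset_antisym[rotated])
qed

lemma quotient_map_suspension_proj:
  assumes "topspace X \<noteq> {}"
  shows "quotient_map (prod_topology X (top_of_set {0..1})) (suspension X) suspension_proj"
proof -
  obtain x where "x \<in> topspace X" using assms by blast
  then have "suspension_proj (x, 0) \<in> suspension_proj ` (topspace X \<times> {0..1})"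
    and "suspension_proj (x, 1) \<in> suspension_proj ` (topspace X \<times> {0..1})"
    by (intro imageI; simp)+
  then have poles: "{South, North} \<subseteq> suspension_proj ` (topspace X \<times> {0..1})"
    by (simp add: suspension_proj_def)
  then have img: "{South, North} \<union> suspension_proj ` (topspace X \<times> {0..1})
      = suspension_proj ` (topspace X \<times> {0..1})" by blast
  show ?thesis
    by (simp add: quotient_map_def topspace_suspension openin_suspension img del: Un_insert_left)
qed

end

theory Submission
  imports Defs
begin

text \<open>Let \<open>C\<^sub>a\<close> consist of the faces of \<open>Ind(H)\<close> that avoid \<open>b\<close> and \<open>c\<close> and do not contain both \<open>v1\<close>
  and \<open>v4\<close>, and let \<open>C\<^sub>c\<close> consist of those that avoid \<open>a\<close> and \<open>d\<close> and do not contain both \<open>v2\<close> and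
  \<open>v3\<close>. Since \<open>{v1, v2}\<close> is an edge, these two subcomplexes cover \<open>Ind(H)\<close>, and their intersection is
  \<open>Ind(G)\<close>. Both are contractible: in \<open>C\<^sub>a\<close> every face containing \<open>v1\<close> can be enlarged by \<open>d\<close>, and the
  faces without \<open>v1\<close> form a cone with apex \<open>a\<close>; in \<open>C\<^sub>c\<close> the vertices \<open>v2\<close>, \<open>b\<close>, \<open>c\<close> play the roles
  of \<open>v1\<close>, \<open>d\<close>, \<open>a\<close>. Hence \<open>Ind(H)\<close> is a suspension of \<open>Ind(G)\<close> up to homotopy. The suspension is
  realized as the independence complex of \<open>G\<close> together with the disjoint edge \<open>{a, c}\<close>, and
  the equivalence is given by explicit piecewise linear maps in barycentric coordinates, whose
  composites are joined to the identities by straight-line homotopies inside faces.\<close>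

section \<open>Barycentric weights on independent sets and straight-line homotopies\<close>

text \<open>The support condition is stated edge by edge and the sum runs over the fixed set
  \<open>V\<close>, so membership is a family of closed conditions that can be checked along a
  segment.\<close>

definition indep_weights :: "'a set \<Rightarrow> 'a set set \<Rightarrow> ('a \<Rightarrow> real) set" where
  "indep_weights V E = {w. (\<forall>v. 0 \<le> w v) \<and> (\<forall>v. v \<notin> V \<longrightarrow> w v = 0) \<and>
     (\<forall>x y. {x, y} \<in> E \<longrightarrow> x \<noteq> y \<longrightarrow> w x = 0 \<or> w y = 0) \<and> sum w V = 1}"

lemma indep_weightsI:
  assumes "\<And>v. 0 \<le> w v" "\<And>v. v \<notin> V \<Longrightarrow> w v = 0"
    and "\<And>x y. {x, y} \<in> E \<Longrightarrow> x \<noteq> y \<Longrightarrow> w x = 0 \<or> w y = 0" "sum w V = 1"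
  shows "w \<in> indep_weights V E"
  using assms by (auto simp: indep_weights_def)

lemma indep_weightsD:
  assumes "w \<in> indep_weights V E"
  shows "0 \<le> w v" "v \<notin> V \<Longrightarrow> w v = 0"
    and "{x, y} \<in> E \<Longrightarrow> x \<noteq> y \<Longrightarrow> w x = 0 \<or> w y = 0" "sum w V = 1"
  using assms by (auto simp: indep_weights_def)

lemma geometric_realization_independence_complex:
  assumes "finite V"
  shows "geometric_realization (independence_complex V E) = top_of_set (indep_weights V E)"
proof -
  have "(\<forall>v. 0 \<le> w v) \<and> {v. w v \<noteq> 0} \<in> independence_complex V E \<and>
      (\<Sum>v | w v \<noteq> 0. w v) = 1 \<longleftrightarrow> w \<in> indep_weights V E" for w :: "'a \<Rightarrow> real"
  proof (cases "{v. w v \<noteq> 0} \<subseteq> V")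
    case True
    then have "(\<Sum>v | w v \<noteq> 0. w v) = sum w V"
      using assms by (intro sum.mono_neutral_left) auto
    moreover have "indep {v. w v \<noteq> 0} E \<longleftrightarrow>
        (\<forall>x y. {x, y} \<in> E \<longrightarrow> x \<noteq> y \<longrightarrow> w x = 0 \<or> w y = 0)"
      unfolding indep_def by blast
    ultimately show ?thesis
      using True by (auto simp: indep_weights_def independence_complex_def)
  qed (auto simp: indep_weights_def independence_complex_def)
  then show ?thesis
    by (simp add: geometric_realization_def)
qed

text \<open>The Euclidean topology on functions is the product topology, so continuity is checked
  one vertex at a time.\<close>

lemma continuous_map_fun_euclidean:
  fixes f :: "'b \<Rightarrow> 'a \<Rightarrow> real"
  shows "continuous_map X euclidean f \<longleftrightarrow> (\<forall>v. continuous_map X euclideanreal (\<lambda>z. f z v))"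
  by (metis (no_types) continuous_map_componentwise_UNIV euclidean_product_topology)

lemma continuous_map_weight:
  assumes "continuous_map X (top_of_set S) f"
  shows "continuous_map X euclideanreal (\<lambda>z. f z v)"
  using assms by (simp add: continuous_map_in_subtopology continuous_map_fun_euclidean)

lemma continuous_map_apply_top_of_set: "continuous_map (top_of_set S) euclideanreal (\<lambda>w. w v)"
  by (intro continuous_map_weight[where S = S and f = id, simplified]) simp

text \<open>By \<open>edge\<close>, the union of the supports of \<open>f z\<close> and
  \<open>g z\<close> is independent, so the segment between them stays inside one face.\<close>

lemma straight_line_homotopic:
  assumes f: "continuous_map X (top_of_set (indep_weights V E)) f"
    and g: "continuous_map X (top_of_set (indep_weights V E)) g"
    and edge: "\<And>z x y. z \<in> topspace X \<Longrightarrow> {x, y} \<in> E \<Longrightarrow> x \<noteq> y \<Longrightarrow>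
      f z x = 0 \<and> g z x = 0 \<or> f z y = 0 \<and> g z y = 0"
  shows "homotopic_with (\<lambda>_. True) X (top_of_set (indep_weights V E)) f g"
proof -
  let ?h = "\<lambda>(t, z) v. (1 - t) * f z v + t * g z v"
  have fg: "f z \<in> indep_weights V E" "g z \<in> indep_weights V E" if "z \<in> topspace X" for z
    using f g that by (auto simp: continuous_map_in_subtopology)
  have "?h (t, z) \<in> indep_weights V E" if t: "t \<in> {0..1}" and z: "z \<in> topspace X" for t z
  proof (rule indep_weightsI)
    show "?h (t, z) x = 0 \<or> ?h (t, z) y = 0" if "{x, y} \<in> E" "x \<noteq> y" for x y
      using edge[OF z that] by auto
  qed (use fg[OF z] t in \<open>auto simp: indep_weights_def sum.distrib simp flip: sum_distrib_left\<close>)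
  moreover have "continuous_map (prod_topology (top_of_set {0..1}) X) euclidean ?h"
    unfolding continuous_map_fun_euclidean case_prod_unfold
  proof (intro allI continuous_map_add continuous_map_real_mult continuous_map_diff)
    fix v
    let ?Y = "prod_topology (top_of_set {0..1::real}) X"
    show "continuous_map ?Y euclideanreal fst" "continuous_map ?Y euclideanreal fst"
      by (rule continuous_map_into_fulltopology[OF continuous_map_fst])+
    show "continuous_map ?Y euclideanreal (\<lambda>p. f (snd p) v)"
      "continuous_map ?Y euclideanreal (\<lambda>p. g (snd p) v)"
      using continuous_map_compose[OF continuous_map_snd continuous_map_weight[OF f, of v]]
        continuous_map_compose[OF continuous_map_snd continuous_map_weight[OF g, of v]]
      by (simp_all add: o_def)
  qed simp
  ultimately show ?thesis
    unfolding homotopic_with_def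
    by (intro exI[of _ ?h]) (auto simp: continuous_map_in_subtopology)
qed

section \<open>The suspension as an independence complex\<close>

text \<open>A closed subset of the cube \<open>?Q\<close>, which is compact by Tychonoff even if the
  vertex type is infinite.\<close>

lemma compact_space_indep_weights:
  assumes "finite V"
  shows "compact_space (top_of_set (indep_weights V E))"
proof -
  let ?Q = "Pi\<^sub>E UNIV (\<lambda>_::'a. {0..1::real})"
  have "compactin (product_topology (\<lambda>_. euclideanreal) UNIV) ?Q"
    by (simp add: compactin_PiE)
  then have "compact ?Q"
    by (simp add: euclidean_product_topology)
  moreover have "closed (indep_weights V E)"
    unfolding indep_weights_def
    by (intro closed_Collect_conj closed_Collect_all closed_Collect_imp closed_Collect_disj
        closed_Collect_le closed_Collect_eq continuous_intros open_Collect_const) auto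
  moreover have "indep_weights V E \<subseteq> ?Q"
  proof
    fix w assume w: "w \<in> indep_weights V E"
    have "w v \<le> 1" for v
    proof (cases "v \<in> V")
      case True
      then show ?thesis
        using w assms member_le_sum[of v V w] by (auto simp: indep_weights_def)
    qed (use w in \<open>simp add: indep_weights_def\<close>)
    then show "w \<in> ?Q" using w by (auto simp: indep_weights_def)
  qed
  ultimately have "compact (indep_weights V E)"
    by (metis compact_Int_closed inf.absorb_iff2)
  then show ?thesis
    by (simp add: compact_space_subtopology)
qed

lemma Hausdorff_space_top_of_set_fun: "Hausdorff_space (top_of_set (S :: ('a \<Rightarrow> real) set))"
  by (metis Hausdorff_space_euclidean Hausdorff_space_product_topology Hausdorff_space_subtopology
      euclidean_product_topology)

text \<open>An independent set of the enlarged graph is one of the old graph plus at most one of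
  \<open>p\<close> and \<open>q\<close>, so the complex is the join with two points. The
  homeomorphism is a continuous bijection from a compact space to a Hausdorff space.\<close>

lemma suspension_indep_weights:
  assumes fin: "finite V" and ne: "V \<noteq> {}" and pq: "p \<notin> V" "q \<notin> V" "p \<noteq> q" and E: "\<Union>E \<subseteq> V"
  shows "suspension (top_of_set (indep_weights V E)) homeomorphic_space
    top_of_set (indep_weights (V \<union> {p, q}) (insert {p, q} E))"
proof -
  let ?L = "indep_weights V E" and ?S = "indep_weights (V \<union> {p, q}) (insert {p, q} E)"
  \<comment> \<open>The coefficients of \<open>x\<close>, \<open>p\<close> and \<open>q\<close> are
    nonnegative and add up to 1. Level 0 goes to \<open>p\<close>, level 1 to \<open>q\<close>, and
    level 1/2 is \<open>?L\<close> itself.\<close>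
  define \<psi> :: "('a \<Rightarrow> real) \<times> real \<Rightarrow> 'a \<Rightarrow> real" where
    "\<psi> = (\<lambda>(x, t) v. (1 - \<bar>2 * t - 1\<bar>) * x v +
       (if v = p then max 0 (1 - 2 * t) else 0) + (if v = q then max 0 (2 * t - 1) else 0))"
  \<comment> \<open>At the poles the coefficient of \<open>x\<close> is 0, so the zero function
    serves as a dummy, although it is not a point of \<open>?L\<close>.\<close>
  define \<phi> where
    "\<phi> s = (case s of South \<Rightarrow> \<psi> (\<lambda>_. 0, 0) | North \<Rightarrow> \<psi> (\<lambda>_. 0, 1) | Level x t \<Rightarrow> \<psi> (x, t))" for s
  have \<phi>_proj: "\<phi> (suspension_proj z) = \<psi> z" for z
    by (cases z) (auto simp: \<phi>_def suspension_proj_def \<psi>_def)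
  obtain u where u: "u \<in> V" using ne by blast
  have x0: "(\<lambda>v. if v = u then 1 else 0) \<in> ?L"
    using u fin by (auto simp: indep_weights_def)
  then have quot: "quotient_map (prod_topology (top_of_set ?L) (top_of_set {0..1}))
      (suspension (top_of_set ?L)) suspension_proj"
    by (intro quotient_map_suspension_proj) auto
  have top: "topspace (suspension (top_of_set ?L)) = suspension_proj ` (?L \<times> {0..1})"
    using quotient_imp_surjective_map[OF quot] by simp
  have \<psi>_mem: "\<psi> (x, t) \<in> ?S" if x: "x \<in> ?L" and t: "t \<in> {0..1}" for x t
  proof -
    have V: "\<psi> (x, t) v = (1 - \<bar>2 * t - 1\<bar>) * x v" if "v \<in> V" for v
      using that pq by (auto simp: \<psi>_def)
    then have sumV: "sum (\<psi> (x, t)) V = 1 - \<bar>2 * t - 1\<bar>"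
      using x by (simp add: indep_weights_def flip: sum_distrib_left)
    have poles: "\<psi> (x, t) p = max 0 (1 - 2 * t)" "\<psi> (x, t) q = max 0 (2 * t - 1)"
      using x pq by (auto simp: \<psi>_def indep_weights_def)
    show ?thesis
    proof (rule indep_weightsI)
      show "0 \<le> \<psi> (x, t) v" for v
        using x t by (auto simp: \<psi>_def indep_weights_def)
      show "\<psi> (x, t) v = 0" if "v \<notin> V \<union> {p, q}" for v
        using that x by (auto simp: \<psi>_def indep_weights_def)
      show "\<psi> (x, t) y = 0 \<or> \<psi> (x, t) z = 0" if yz: "{y, z} \<in> insert {p, q} E" "y \<noteq> z" for y z
      proof (cases "{y, z} \<in> E")
        case True
        then have "y \<in> V" "z \<in> V" using E by auto
        then show ?thesis using V indep_weightsD(3)[OF x True yz(2)] by auto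
      qed (use yz poles in \<open>auto simp: doubleton_eq_iff\<close>)
      show "sum (\<psi> (x, t)) (V \<union> {p, q}) = 1"
        using fin pq sumV poles by (auto simp: max_def)
    qed
  qed
  have surj: "y \<in> \<psi> ` (?L \<times> {0..1})" if y: "y \<in> ?S" for y
  proof -
    have nn: "0 \<le> y v" for v using y by (simp add: indep_weights_def)
    have pq0: "y p = 0 \<or> y q = 0" using y pq by (auto simp: indep_weights_def)
    have sum: "sum y V = 1 - y p - y q"
      using y pq fin by (simp add: indep_weights_def)
    \<comment> \<open>\<open>s\<close> is the weight left for \<open>V\<close>, and \<open>t\<close>
      solves \<open>2 * t - 1 = y q - y p\<close>; as \<open>y p\<close> or \<open>y q\<close> is 0,
      the positive and negative parts of this difference are \<open>y q\<close> and
      \<open>y p\<close>.\<close>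
    define s where "s = 1 - y p - y q"
    define t where "t = (1 + y q - y p) / 2"
    have s0: "0 \<le> s" using sum nn by (metis s_def sum_nonneg)
    have t: "t \<in> {0..1}" "1 - \<bar>2 * t - 1\<bar> = s" "max 0 (1 - 2 * t) = y p" "max 0 (2 * t - 1) = y q"
      using pq0 nn[of p] nn[of q] s0 by (auto simp: t_def s_def field_simps)
    show ?thesis
    proof (cases "s = 0")
      case True
      then have "\<forall>v\<in>V. y v = 0"
        using sum fin nn by (simp add: s_def sum_nonneg_eq_0_iff)
      \<comment> \<open>Here \<open>y\<close> is a pole, and any point of \<open>?L\<close> is a
        suitable first coordinate.\<close>
      then have "\<psi> (\<lambda>v. if v = u then 1 else 0, t) = y"
        using t True y pq by (auto simp: \<psi>_def fun_eq_iff indep_weights_def)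
      then show ?thesis using x0 t(1) by (intro image_eqI[of _ _ "(_, t)"]) auto
    next
      case False
      let ?x = "\<lambda>v. if v \<in> V then y v / s else 0"
      have "sum ?x V = 1"
        using sum False by (simp add: s_def flip: sum_divide_distrib)
      then have "?x \<in> ?L"
        using y nn s0 by (auto simp: indep_weights_def)
      moreover have "\<psi> (?x, t) = y"
        using t False y pq by (auto simp: \<psi>_def fun_eq_iff indep_weights_def)
      ultimately show ?thesis using t(1) by (intro image_eqI[of _ _ "(?x, t)"]) auto
    qed
  qed
  have inj: "suspension_proj (x, t) = suspension_proj (x', t')"
    if x: "x \<in> ?L" and x': "x' \<in> ?L" and t: "t \<in> {0..1}" "t' \<in> {0..1}"
      and eq: "\<psi> (x, t) = \<psi> (x', t')" for x x' t t'
  proof -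
    have "x p = 0" "x q = 0" "x' p = 0" "x' q = 0" using x x' pq by (auto simp: indep_weights_def)
    then have "max 0 (1 - 2 * t) = max 0 (1 - 2 * t')" "max 0 (2 * t - 1) = max 0 (2 * t' - 1)"
      using fun_cong[OF eq, of p] fun_cong[OF eq, of q] pq by (auto simp: \<psi>_def)
    then have tt: "t = t'" by (auto simp: max_def split: if_splits)
    show ?thesis
    proof (cases "t = 0 \<or> t = 1")
      case False
      then have "1 - \<bar>2 * t - 1\<bar> \<noteq> 0" using t by auto
      then have "x v = x' v" for v
        using fun_cong[OF eq, of v] tt by (auto simp: \<psi>_def)
      then show ?thesis using tt by (metis ext)
    qed (use tt in \<open>auto simp: suspension_proj_def\<close>)
  qed
  have cont: "continuous_map (prod_topology (top_of_set ?L) (top_of_set {0..1})) euclidean \<psi>"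
    unfolding continuous_map_fun_euclidean \<psi>_def case_prod_unfold
  proof (intro allI continuous_map_add continuous_map_real_mult)
    fix v
    let ?Y = "prod_topology (top_of_set ?L) (top_of_set {0..1::real})"
    have t: "continuous_map ?Y euclideanreal snd"
      by (rule continuous_map_into_fulltopology[OF continuous_map_snd])
    have cc: "continuous_map ?Y euclideanreal (\<lambda>z. r (snd z))" if "continuous_on UNIV r"
      for r :: "real \<Rightarrow> real"
      using continuous_map_compose[OF t, of euclideanreal r] that by (simp add: o_def)
    show "continuous_map ?Y euclideanreal (\<lambda>z. 1 - \<bar>2 * snd z - 1\<bar>)"
      by (intro cc continuous_intros)
    show "continuous_map ?Y euclideanreal (\<lambda>z. if v = p then max 0 (1 - 2 * snd z) else 0)"
      by (cases "v = p") (auto intro!: cc continuous_intros)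
    show "continuous_map ?Y euclideanreal (\<lambda>z. if v = q then max 0 (2 * snd z - 1) else 0)"
      by (cases "v = q") (auto intro!: cc continuous_intros)
    show "continuous_map ?Y euclideanreal (\<lambda>z. fst z v)"
      by (intro continuous_map_weight[OF continuous_map_fst])
  qed
  have "continuous_map (suspension (top_of_set ?L)) (top_of_set ?S) \<phi>"
  proof (rule continuous_compose_quotient_map[OF quot])
    have "\<phi> \<circ> suspension_proj = \<psi>" by (auto simp: \<phi>_proj)
    then show "continuous_map (prod_topology (top_of_set ?L) (top_of_set {0..1})) (top_of_set ?S)
        (\<phi> \<circ> suspension_proj)"
      using cont \<psi>_mem by (auto simp: continuous_map_in_subtopology)
  qed
  moreover have "compact_space (suspension (top_of_set ?L))"
  proof -
    have "compact_space (prod_topology (top_of_set ?L) (top_of_set {0..1::real}))"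
      unfolding compact_space_prod_topology
      using compact_space_indep_weights[OF fin] by (simp add: compact_space_subtopology)
    then show ?thesis
      using image_compactin[OF _ quotient_imp_continuous_map[OF quot]]
        quotient_imp_surjective_map[OF quot]
      by (metis compact_space_def)
  qed
  moreover have "\<phi> ` topspace (suspension (top_of_set ?L)) = topspace (top_of_set ?S)"
    using \<psi>_mem surj by (auto simp: top image_image \<phi>_proj)
  moreover have "inj_on \<phi> (topspace (suspension (top_of_set ?L)))"
  proof (rule inj_onI, unfold top)
    fix y y' assume "y \<in> suspension_proj ` (?L \<times> {0..1})" "y' \<in> suspension_proj ` (?L \<times> {0..1})"
      and eq: "\<phi> y = \<phi> y'"
    then obtain x t x' t' where y: "y = suspension_proj (x, t)" "y' = suspension_proj (x', t')"
      and mem: "x \<in> ?L" "x' \<in> ?L" "t \<in> {0..1}" "t' \<in> {0..1}" by blast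
    have "\<psi> (x, t) = \<psi> (x', t')" using eq by (simp add: y \<phi>_proj)
    then show "y = y'" unfolding y by (rule inj[OF mem])
  qed
  ultimately have "homeomorphic_map (suspension (top_of_set ?L)) (top_of_set ?S) \<phi>"
    using continuous_imp_homeomorphic_map Hausdorff_space_top_of_set_fun by blast
  then show ?thesis
    using homeomorphic_map_imp_homeomorphic_space by blast
qed

text \<open>The conditionals in the maps below test the vertex and not the point, so no pasting is
  involved.\<close>

lemma continuous_map_if_const:
  assumes "continuous_map X Y f" "continuous_map X Y g"
  shows "continuous_map X Y (\<lambda>x. if Q then f x else g x)"
  using assms by simp

section \<open>The graph \<open>H\<close> and membership in the two complexes\<close>

locale crossed_edges =
  fixes V :: "'a set" and E :: "'a set set" and v1 v2 v3 v4 a b c d :: 'a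
  assumes graph: "finite_simple_graph V E"
    and in_V: "{v1, v2, v3, v4} \<subseteq> V" and dist_V: "distinct [v1, v2, v3, v4]"
    and edges: "{v1, v4} \<in> E" "{v2, v3} \<in> E" "{v1, v2} \<in> E"
    and new: "{a, b, c, d} \<inter> V = {}" and dist_new: "distinct [a, b, c, d]"
begin

definition H :: "'a set" where "H = V \<union> {a, b, c, d}"

definition EH :: "'a set set" where
  "EH = (E - {{v1, v4}, {v2, v3}}) \<union>
     {{v1, a}, {a, b}, {b, v3}, {v2, c}, {c, d}, {d, v4}, {a, c}, {b, d}}"

abbreviation "X \<equiv> indep_weights H EH"
text \<open>With \<open>a\<close> and \<open>c\<close> as poles, both complexes carry weights on
  \<open>H\<close>, and maps between them merely shift weight.\<close>

abbreviation "S \<equiv> indep_weights (V \<union> {a, c}) (insert {a, c} E)"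

lemma fin: "finite V" "finite H"
  using graph by (auto simp: finite_simple_graph_def H_def)

lemma E_V: "{x, y} \<in> E \<Longrightarrow> x \<in> V" "{x, y} \<in> E \<Longrightarrow> y \<in> V"
  using graph by (auto simp: finite_simple_graph_def nsets_def)

lemma dist: "distinct [v1, v2, v3, v4, a, b, c, d]"
  using in_V dist_V new dist_new by auto

text \<open>Supplies every inequality in the opposite orientation for simplification.\<close>

lemma dist_rev: "distinct [d, c, b, a, v4, v3, v2, v1]"
  using dist by auto

lemmas dist_simps [simp] = dist[simplified] dist_rev[simplified]

lemma in_H: "v1 \<in> H" "v2 \<in> H" "v3 \<in> H" "v4 \<in> H" "a \<in> H" "b \<in> H" "c \<in> H" "d \<in> H"
  using in_V by (auto simp: H_def)

lemma sum_point: "v \<in> H \<Longrightarrow> (\<Sum>u\<in>H. if u = v then k else 0) = (k :: real)"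
  using fin by simp

lemma old_edge_in_EH: "e \<in> E \<Longrightarrow> e \<noteq> {v1, v4} \<Longrightarrow> e \<noteq> {v2, v3} \<Longrightarrow> e \<in> EH"
  by (simp add: EH_def)

lemma EH_cases:
  assumes "e \<in> EH"
  obtains (old) "e \<in> E" "e \<noteq> {v1, v4}" "e \<noteq> {v2, v3}"
    | (new) x y where "e = {x, y}"
        "(x, y) \<in> {(v1, a), (a, b), (b, v3), (v2, c), (c, d), (d, v4), (a, c), (b, d)}"
  using assms unfolding EH_def by auto

lemma X_edge:
  assumes "w \<in> X"
  shows "w v1 = 0 \<or> w v2 = 0" "w v1 = 0 \<or> w a = 0" "w a = 0 \<or> w b = 0" "w b = 0 \<or> w v3 = 0"
    "w v2 = 0 \<or> w c = 0" "w c = 0 \<or> w d = 0" "w d = 0 \<or> w v4 = 0" "w a = 0 \<or> w c = 0"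
    "w b = 0 \<or> w d = 0"
  using dist edges by (intro indep_weightsD(3)[OF assms]; auto simp: EH_def doubleton_eq_iff)+

lemma X_old_edge:
  assumes "w \<in> X" "{x, y} \<in> E" "x \<noteq> y"
  shows "{x, y} = {v1, v4} \<or> {x, y} = {v2, v3} \<or> w x = 0 \<or> w y = 0"
  using indep_weightsD(3)[OF assms(1) _ assms(3)] old_edge_in_EH[OF assms(2)] by satx

lemma S_edge:
  assumes "u \<in> S"
  shows "u v1 = 0 \<or> u v2 = 0" "u v1 = 0 \<or> u v4 = 0" "u v2 = 0 \<or> u v3 = 0" "u a = 0 \<or> u c = 0"
    "u b = 0" "u d = 0"
proof -
  show "u v1 = 0 \<or> u v2 = 0" "u v1 = 0 \<or> u v4 = 0" "u v2 = 0 \<or> u v3 = 0" "u a = 0 \<or> u c = 0"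
    by (rule indep_weightsD(3)[OF assms], use edges dist in simp, use dist in simp)+
  show "u b = 0" "u d = 0"
    using new dist by (auto intro!: indep_weightsD(2)[OF assms])
qed

lemma S_sum:
  assumes "u \<in> S"
  shows "sum u H = 1"
proof -
  have "sum u (V \<union> {a, c}) = sum u H"
    by (rule sum.mono_neutral_left) (use fin indep_weightsD(2)[OF assms] in \<open>auto simp: H_def\<close>)
  then show ?thesis using indep_weightsD(4)[OF assms] by simp
qed

lemma X_I:
  assumes "\<And>v. 0 \<le> w v" "\<And>v. v \<notin> H \<Longrightarrow> w v = 0" "sum w H = 1"
    and "\<And>x y. {x, y} \<in> E \<Longrightarrow> {x, y} \<noteq> {v1, v4} \<Longrightarrow> {x, y} \<noteq> {v2, v3} \<Longrightarrow> x \<noteq> y \<Longrightarrow> w x = 0 \<or> w y = 0"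
    and "w v1 = 0 \<or> w a = 0" "w a = 0 \<or> w b = 0" "w b = 0 \<or> w v3 = 0"
    "w v2 = 0 \<or> w c = 0" "w c = 0 \<or> w d = 0" "w d = 0 \<or> w v4 = 0" "w a = 0 \<or> w c = 0"
    "w b = 0 \<or> w d = 0"
  shows "w \<in> X"
proof (rule indep_weightsI)
  fix x y assume "{x, y} \<in> EH" "x \<noteq> y"
  from this(1) show "w x = 0 \<or> w y = 0"
  proof (cases rule: EH_cases)
    case old
    then show ?thesis using assms(4) \<open>x \<noteq> y\<close> by blast
  next
    case (new x' y')
    then have "w x' = 0 \<or> w y' = 0" using assms(5-) by auto
    then show ?thesis using new(1) by (auto simp: doubleton_eq_iff)
  qed
qed (fact assms)+

lemma S_I:
  assumes "\<And>v. 0 \<le> w v" "\<And>v. v \<notin> H \<Longrightarrow> w v = 0" "sum w H = 1"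
    and "\<And>x y. {x, y} \<in> E \<Longrightarrow> x \<noteq> y \<Longrightarrow> w x = 0 \<or> w y = 0"
    and "w a = 0 \<or> w c = 0" "w b = 0" "w d = 0"
  shows "w \<in> S"
proof (rule indep_weightsI)
  show supp: "w v = 0" if "v \<notin> V \<union> {a, c}" for v
    using that assms(2)[of v] assms(6,7) by (auto simp: H_def)
  have "sum w (V \<union> {a, c}) = sum w H"
    by (rule sum.mono_neutral_left) (use fin supp in \<open>auto simp: H_def\<close>)
  then show "sum w (V \<union> {a, c}) = 1" using assms(3) by simp
  show "w x = 0 \<or> w y = 0" if "{x, y} \<in> insert {a, c} E" "x \<noteq> y" for x y
    using that assms(4,5) unfolding insert_iff doubleton_eq_iff by blast
qed (fact assms)

lemma X_homotopic:
  assumes f: "continuous_map Z (top_of_set X) f" and g: "continuous_map Z (top_of_set X) g"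
    and old: "\<And>z x y. z \<in> topspace Z \<Longrightarrow> {x, y} \<in> E \<Longrightarrow> {x, y} \<noteq> {v1, v4} \<Longrightarrow> {x, y} \<noteq> {v2, v3} \<Longrightarrow>
      x \<noteq> y \<Longrightarrow> f z x = 0 \<and> g z x = 0 \<or> f z y = 0 \<and> g z y = 0"
    and new: "\<And>z x y. z \<in> topspace Z \<Longrightarrow>
      (x, y) \<in> {(v1, a), (a, b), (b, v3), (v2, c), (c, d), (d, v4), (a, c), (b, d)} \<Longrightarrow>
      f z x = 0 \<and> g z x = 0 \<or> f z y = 0 \<and> g z y = 0"
  shows "homotopic_with (\<lambda>_. True) Z (top_of_set X) f g"
proof (rule straight_line_homotopic[OF f g])
  fix z x y assume z: "z \<in> topspace Z" and xy: "{x, y} \<in> EH" "x \<noteq> y"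
  from xy(1) show "f z x = 0 \<and> g z x = 0 \<or> f z y = 0 \<and> g z y = 0"
  proof (cases rule: EH_cases)
    case old
    then show ?thesis using assms(3)[OF z] xy(2) by blast
  next
    case (new x' y')
    then show ?thesis using assms(4)[OF z new(2)] unfolding doubleton_eq_iff by blast
  qed
qed

section \<open>The maps between the two complexes\<close>

text \<open>The weight that \<open>collapse\<close> puts at \<open>a\<close>; the factor 2 appears
  because \<open>min (w v2) (w v3)\<close> is taken from both \<open>v2\<close> and
  \<open>v3\<close>.\<close>

definition mass_a :: "('a \<Rightarrow> real) \<Rightarrow> real" where
  "mass_a w = w a + w d + 2 * min (w v2) (w v3)"

definition mass_c :: "('a \<Rightarrow> real) \<Rightarrow> real" where
  "mass_c w = w c + w b + 2 * min (w v1) (w v4)"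

text \<open>The weight outside \<open>Ind(G)\<close> is moved to the cone points: on \<open>C\<^sub>a\<close> this is the weight of
  \<open>a\<close> and \<open>d\<close>, and that of the edge \<open>{v2, v3}\<close>, which is not a face of \<open>Ind(G)\<close>; symmetrically
  on \<open>C\<^sub>c\<close>.\<close>

definition collapse :: "('a \<Rightarrow> real) \<Rightarrow> 'a \<Rightarrow> real" where
  "collapse w v = w v
     + (if v = a then w d + 2 * min (w v2) (w v3) else 0) + (if v = d then - w d else 0)
     + (if v = v2 then - min (w v2) (w v3) else 0) + (if v = v3 then - min (w v2) (w v3) else 0)
     + (if v = c then w b + 2 * min (w v1) (w v4) else 0) + (if v = b then - w b else 0)
     + (if v = v1 then - min (w v1) (w v4) else 0) + (if v = v4 then - min (w v1) (w v4) else 0)"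

text \<open>\<open>C\<^sub>a\<close> contracts in two steps: \<open>v1\<close> is pushed to \<open>d\<close>, which dominates it there, and the rest is
  coned off from \<open>a\<close>. Equal amounts at \<open>a\<close> and \<open>v1\<close> are merged into \<open>d\<close>, so that \<open>a\<close> keeps
  weight only when \<open>v1\<close> has none.\<close>

definition expand :: "('a \<Rightarrow> real) \<Rightarrow> 'a \<Rightarrow> real" where
  "expand u v = u v
     + (if v = a then - min (u v1) (u a) else 0) + (if v = v1 then - min (u v1) (u a) else 0)
     + (if v = d then 2 * min (u v1) (u a) else 0)
     + (if v = c then - min (u v2) (u c) else 0) + (if v = v2 then - min (u v2) (u c) else 0)
     + (if v = b then 2 * min (u v2) (u c) else 0)"

text \<open>Intermediate map: the supports of \<open>w\<close> and \<open>expand (collapse w)\<close> need not span a common face, as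
  \<open>v1\<close> may lie in one and \<open>a\<close> in the other.\<close>

definition push :: "('a \<Rightarrow> real) \<Rightarrow> 'a \<Rightarrow> real" where
  "push w v = w v
     + (if v = v1 then - min (w v1) (mass_a w) else 0) + (if v = d then min (w v1) (mass_a w) else 0)
     + (if v = v2 then - min (w v2) (mass_c w) else 0) + (if v = b then min (w v2) (mass_c w) else 0)"

lemma collapse_simps [simp]:
  "collapse w a = mass_a w" "collapse w c = mass_c w" "collapse w b = 0" "collapse w d = 0"
  "collapse w v1 = w v1 - min (w v1) (w v4)" "collapse w v4 = w v4 - min (w v1) (w v4)"
  "collapse w v2 = w v2 - min (w v2) (w v3)" "collapse w v3 = w v3 - min (w v2) (w v3)"
  and collapse_other: "v \<notin> {v1, v2, v3, v4, a, b, c, d} \<Longrightarrow> collapse w v = w v"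
  by (simp_all add: collapse_def mass_a_def mass_c_def)

lemma expand_simps [simp]:
  "expand u a = u a - min (u v1) (u a)" "expand u c = u c - min (u v2) (u c)"
  "expand u b = u b + 2 * min (u v2) (u c)" "expand u d = u d + 2 * min (u v1) (u a)"
  "expand u v1 = u v1 - min (u v1) (u a)" "expand u v2 = u v2 - min (u v2) (u c)"
  "expand u v3 = u v3" "expand u v4 = u v4"
  and expand_other: "v \<notin> {v1, v2, v3, v4, a, b, c, d} \<Longrightarrow> expand u v = u v"
  by (simp_all add: expand_def)

lemma push_simps [simp]:
  "push w a = w a" "push w c = w c"
  "push w b = w b + min (w v2) (mass_c w)" "push w d = w d + min (w v1) (mass_a w)"
  "push w v1 = w v1 - min (w v1) (mass_a w)" "push w v2 = w v2 - min (w v2) (mass_c w)"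
  "push w v3 = w v3" "push w v4 = w v4"
  and push_other: "v \<notin> {v1, v2, v3, v4, a, b, c, d} \<Longrightarrow> push w v = w v"
  by (simp_all add: push_def)

text \<open>What is added at \<open>a\<close> and \<open>c\<close> is exactly what is removed
  elsewhere.\<close>

lemma sum_collapse: "sum (collapse w) H = sum w H"
  unfolding collapse_def by (simp add: sum.distrib sum_point in_H)

lemma sum_expand: "sum (expand w) H = sum w H"
  unfolding expand_def by (simp add: sum.distrib sum_point in_H)

lemma sum_push: "sum (push w) H = sum w H"
  unfolding push_def by (simp add: sum.distrib sum_point in_H)

lemma mass_nonneg:
  assumes "\<And>v. 0 \<le> w v"
  shows "0 \<le> mass_a w" "0 \<le> mass_c w" "w a \<le> mass_a w" "w d \<le> mass_a w"
    "w c \<le> mass_c w" "w b \<le> mass_c w"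
  using assms by (auto simp: mass_a_def mass_c_def)

section \<open>The cover of \<open>Ind(H)\<close> and well-definedness of the maps\<close>

text \<open>The cover by \<open>C\<^sub>a\<close> (first case) and \<open>C\<^sub>c\<close> (second
  case). Outside \<open>C\<^sub>c\<close> the support contains \<open>a\<close>, or
  \<open>d\<close>, or both \<open>v2\<close> and \<open>v3\<close>; each of these excludes
  \<open>b\<close>, \<open>c\<close> and one of \<open>v1\<close>, \<open>v4\<close>, the last one
  through the edge \<open>{v1, v2}\<close>.\<close>

lemma X_cases:
  assumes w: "w \<in> X"
  obtains "mass_c w = 0" "w b = 0" "w c = 0" "w v1 = 0 \<or> w v4 = 0"
    | "mass_a w = 0" "w a = 0" "w d = 0" "w v2 = 0 \<or> w v3 = 0"
proof (cases "w a = 0 \<and> w d = 0 \<and> (w v2 = 0 \<or> w v3 = 0)")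
  case True
  then have "mass_a w = 0"
    using indep_weightsD(1)[OF w, of v2] indep_weightsD(1)[OF w, of v3] by (auto simp: mass_a_def)
  then show ?thesis using True that(2) by blast
next
  case False
  then have *: "w b = 0" "w c = 0" "w v1 = 0 \<or> w v4 = 0"
    using X_edge[OF w] by blast+
  then have "mass_c w = 0"
    using indep_weightsD(1)[OF w, of v1] indep_weightsD(1)[OF w, of v4] by (auto simp: mass_c_def)
  then show ?thesis using * that(1) by blast
qed

lemma old_vertex_cases:
  assumes "v \<in> V"
  obtains "v = v1" | "v = v2" | "v = v3" | "v = v4" | "v \<notin> {v1, v2, v3, v4, a, b, c, d}"
  using assms new by blast

text \<open>On old vertices the maps only remove weight, so edge conditions inside \<open>V\<close>
  are inherited; the same holds for \<open>expand\<close> and \<open>push\<close>.\<close>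

lemma collapse_le:
  assumes "\<And>v. 0 \<le> w v" "v \<in> V"
  shows "0 \<le> collapse w v" "collapse w v \<le> w v"
  using assms(2) by (cases rule: old_vertex_cases; use assms(1) in \<open>simp add: collapse_other\<close>)+

lemma collapse_zero:
  assumes "\<And>v. 0 \<le> w v" "v \<in> V" "w v = 0"
  shows "collapse w v = 0"
  using collapse_le[of w v, OF assms(1,2)] assms(3) by simp

lemma expand_le:
  assumes "\<And>v. 0 \<le> u v" "v \<in> V"
  shows "0 \<le> expand u v" "expand u v \<le> u v"
  using assms(2) by (cases rule: old_vertex_cases; use assms(1) in \<open>simp add: expand_other\<close>)+

lemma expand_zero:
  assumes "\<And>v. 0 \<le> u v" "v \<in> V" "u v = 0"
  shows "expand u v = 0"
  using expand_le[of u v, OF assms(1,2)] assms(3) by simp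

lemma push_le:
  assumes "\<And>v. 0 \<le> w v" "v \<in> V"
  shows "0 \<le> push w v" "push w v \<le> w v"
  using assms(2)
  by (cases rule: old_vertex_cases; use assms(1) mass_nonneg[of w] in \<open>simp add: push_other\<close>)+

lemma push_zero:
  assumes "\<And>v. 0 \<le> w v" "v \<in> V" "w v = 0"
  shows "push w v = 0"
  using push_le[of w v, OF assms(1,2)] assms(3) by simp

lemma vertex_cases:
  obtains "v \<in> V" | "v = a" | "v = b" | "v = c" | "v = d" | "v \<notin> H"
    "v \<notin> {v1, v2, v3, v4, a, b, c, d}"
  using in_V by (auto simp: H_def)

text \<open>Subtracting the minimum clears an end of each of \<open>{v1, v4}\<close> and
  \<open>{v2, v3}\<close>, the edges missing in \<open>H\<close>. By the cover, one of the two
  masses is 0.\<close>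

lemma collapse_mem:
  assumes w: "w \<in> X"
  shows "collapse w \<in> S"
proof (rule S_I)
  note nn = indep_weightsD(1)[OF w]
  show "0 \<le> collapse w v" for v
    by (cases rule: vertex_cases[of v]) (use nn mass_nonneg[of w, OF nn] in \<open>auto simp: collapse_le collapse_other\<close>)
  show "collapse w v = 0" if "v \<notin> H" for v
    using that in_H indep_weightsD(2)[OF w that] by (subst collapse_other) auto
  show "sum (collapse w) H = 1" using indep_weightsD(4)[OF w] by (simp add: sum_collapse)
  show "collapse w a = 0 \<or> collapse w c = 0" by (cases rule: X_cases[OF w]) auto
  show "collapse w x = 0 \<or> collapse w y = 0" if xy: "{x, y} \<in> E" "x \<noteq> y" for x y
  proof -
    consider "{x, y} = {v1, v4}" | "{x, y} = {v2, v3}" | "w x = 0" | "w y = 0"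
      using X_old_edge[OF w xy] by blast
    then show ?thesis
    proof cases
      case 3
      then show ?thesis using collapse_zero[of w, OF nn E_V(1)[OF xy(1)]] by simp
    next
      case 4
      then show ?thesis using collapse_zero[of w, OF nn E_V(2)[OF xy(1)]] by simp
    qed (auto simp: doubleton_eq_iff min_def split: if_splits)
  qed
qed simp_all

text \<open>\<open>d\<close> gets weight only if \<open>u\<close> is positive at \<open>v1\<close>
  and \<open>a\<close>; the edges at these vertices then exclude \<open>v2\<close>,
  \<open>v4\<close> and \<open>c\<close>, hence also \<open>b\<close>. The case of \<open>b\<close>
  is symmetric.\<close>

lemma expand_mem:
  assumes u: "u \<in> S"
  shows "expand u \<in> X"
proof (rule X_I)
  note nn = indep_weightsD(1)[OF u]
  note e = S_edge[OF u]
  show "0 \<le> expand u v" for v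
    by (cases rule: vertex_cases[of v]) (use nn in \<open>auto simp: expand_le expand_other\<close>)
  show "expand u v = 0" if "v \<notin> H" for v
    using that in_H indep_weightsD(2)[OF u, of v] by (subst expand_other) (auto simp: H_def)
  show "sum (expand u) H = 1" using S_sum[OF u] by (simp add: sum_expand)
  show "expand u x = 0 \<or> expand u y = 0" if "{x, y} \<in> E" "x \<noteq> y" for x y
    using indep_weightsD(3)[OF u insertI2[OF that(1)] that(2)] expand_zero[of u, OF nn E_V(1)[OF that(1)]]
      expand_zero[of u, OF nn E_V(2)[OF that(1)]] by satx
  show "expand u v1 = 0 \<or> expand u a = 0" "expand u v2 = 0 \<or> expand u c = 0" by auto
  show "expand u a = 0 \<or> expand u b = 0" "expand u b = 0 \<or> expand u v3 = 0" "expand u c = 0 \<or> expand u d = 0"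
    "expand u d = 0 \<or> expand u v4 = 0" "expand u a = 0 \<or> expand u c = 0" "expand u b = 0 \<or> expand u d = 0"
    using e nn[of v1] nn[of v2] nn[of a] nn[of c] by (auto simp: min_def)
qed

text \<open>In \<open>C\<^sub>a\<close>, \<open>b\<close> and \<open>c\<close> stay 0, and
  \<open>d\<close> gains weight only if \<open>v1\<close> has some, which forces \<open>v4\<close>
  to be 0.\<close>

lemma push_mem:
  assumes w: "w \<in> X"
  shows "push w \<in> X"
proof (rule X_I)
  note nn = indep_weightsD(1)[OF w]
  note e = X_edge[OF w]
  note m = mass_nonneg[of w, OF nn]
  show "0 \<le> push w v" for v
    by (cases rule: vertex_cases[of v]) (use nn m in \<open>auto simp: push_le push_other\<close>)
  show "push w v = 0" if "v \<notin> H" for v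
    using that in_H indep_weightsD(2)[OF w that] by (subst push_other) auto
  show "sum (push w) H = 1" using indep_weightsD(4)[OF w] by (simp add: sum_push)
  show "push w x = 0 \<or> push w y = 0" if "{x, y} \<in> E" "{x, y} \<noteq> {v1, v4}" "{x, y} \<noteq> {v2, v3}" "x \<noteq> y" for x y
    using X_old_edge[OF w that(1,4)] that(2,3)
      push_zero[of w, OF nn E_V(1)[OF that(1)]] push_zero[of w, OF nn E_V(2)[OF that(1)]] by auto
  show "push w v1 = 0 \<or> push w a = 0" "push w a = 0 \<or> push w b = 0" "push w b = 0 \<or> push w v3 = 0"
    "push w v2 = 0 \<or> push w c = 0" "push w c = 0 \<or> push w d = 0" "push w d = 0 \<or> push w v4 = 0"
    "push w a = 0 \<or> push w c = 0" "push w b = 0 \<or> push w d = 0"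
    by (cases rule: X_cases[OF w]; use e nn[of v1] nn[of v2] m in \<open>auto simp: min_def\<close>)+
qed

lemma continuous_collapse: "continuous_map (top_of_set X) (top_of_set S) collapse"
  using collapse_mem unfolding continuous_map_in_subtopology continuous_map_fun_euclidean collapse_def
  by (intro conjI allI continuous_map_add continuous_map_if_const continuous_map_minus
      continuous_map_real_mult continuous_map_real_min continuous_map_apply_top_of_set) auto

lemma continuous_expand: "continuous_map (top_of_set S) (top_of_set X) expand"
  using expand_mem unfolding continuous_map_in_subtopology continuous_map_fun_euclidean expand_def
  by (intro conjI allI continuous_map_add continuous_map_if_const continuous_map_minus
      continuous_map_real_mult continuous_map_real_min continuous_map_apply_top_of_set) auto

lemma continuous_push: "continuous_map (top_of_set X) (top_of_set X) push"
  using push_mem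
  unfolding continuous_map_in_subtopology continuous_map_fun_euclidean push_def mass_a_def mass_c_def
  by (intro conjI allI continuous_map_add continuous_map_if_const continuous_map_minus
      continuous_map_real_mult continuous_map_real_min continuous_map_apply_top_of_set) auto

section \<open>The homotopies\<close>

text \<open>The composite creates no new support: weight moved to \<open>b\<close> or
  \<open>d\<close> by \<open>expand\<close> returns to \<open>c\<close> or \<open>a\<close>, which
  had weight already.\<close>

lemma collapse_expand_homotopic_id: "homotopic_with (\<lambda>_. True) (top_of_set S) (top_of_set S) (collapse \<circ> expand) id"
proof (rule straight_line_homotopic)
  show "continuous_map (top_of_set S) (top_of_set S) (collapse \<circ> expand)"
    using continuous_expand continuous_collapse by (rule continuous_map_compose)
  fix u x y assume "u \<in> topspace (top_of_set S)" and xy: "{x, y} \<in> insert {a, c} E" "x \<noteq> y"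
  then have u: "u \<in> S" by simp
  note nn = indep_weightsD(1)[OF u]
  have expand_nn: "0 \<le> expand u v" for v using indep_weightsD(1)[OF expand_mem[OF u]] .
  have "collapse (expand u) v = 0" if "v \<in> V \<union> {a, c}" "u v = 0" for v
  proof -
    consider "v \<in> V" | "v = a" | "v = c" using \<open>v \<in> V \<union> {a, c}\<close> by blast
    then show ?thesis
    proof cases
      case 1
      then show ?thesis
        using collapse_zero[of "expand u", OF expand_nn 1 expand_zero[of u, OF nn 1 \<open>u v = 0\<close>]] by simp
    qed (use \<open>u v = 0\<close> S_edge[OF u] nn[of v1] nn[of v2] nn[of v3] nn[of v4] nn[of a] nn[of c] in
        \<open>auto simp: mass_a_def mass_c_def min_def\<close>)
  qed
  moreover have "x \<in> V \<union> {a, c}" "y \<in> V \<union> {a, c}"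
    using xy E_V by (auto simp: doubleton_eq_iff)
  ultimately show "(collapse \<circ> expand) u x = 0 \<and> id u x = 0 \<or> (collapse \<circ> expand) u y = 0 \<and> id u y = 0"
    using indep_weightsD(3)[OF u xy] by auto
qed simp_all

text \<open>In \<open>C\<^sub>a\<close>, the support grows at most by \<open>d\<close>, and only
  when \<open>v1\<close> is in it; the neighbours \<open>b\<close>, \<open>c\<close>,
  \<open>v4\<close> of \<open>d\<close> are then absent.\<close>

lemma push_homotopic_id: "homotopic_with (\<lambda>_. True) (top_of_set X) (top_of_set X) push id"
proof (rule X_homotopic)
  fix w assume "w \<in> topspace (top_of_set X)"
  then have w: "w \<in> X" by simp
  note nn = indep_weightsD(1)[OF w]
  note m = mass_nonneg[of w, OF nn]
  show "push w x = 0 \<and> id w x = 0 \<or> push w y = 0 \<and> id w y = 0"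
    if "{x, y} \<in> E" "{x, y} \<noteq> {v1, v4}" "{x, y} \<noteq> {v2, v3}" "x \<noteq> y" for x y
    using X_old_edge[OF w that(1,4)] that(2,3)
      push_zero[of w, OF nn E_V(1)[OF that(1)]] push_zero[of w, OF nn E_V(2)[OF that(1)]] by auto
  \<comment> \<open>The disjunctive form allows each of the eight new edges to be split along the
    cover separately.\<close>
  have *: "push w x = 0 \<and> w x = 0 \<or> push w y = 0 \<and> w y = 0"
    if "(x, y) = (v1, a) \<or> (x, y) = (a, b) \<or> (x, y) = (b, v3) \<or> (x, y) = (v2, c) \<or>
        (x, y) = (c, d) \<or> (x, y) = (d, v4) \<or> (x, y) = (a, c) \<or> (x, y) = (b, d)" for x y
    using that
    by (elim disjE; cases rule: X_cases[OF w];
        use X_edge[OF w] nn[of v1] nn[of v2] m in \<open>auto simp: min_def\<close>)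
  show "push w x = 0 \<and> id w x = 0 \<or> push w y = 0 \<and> id w y = 0"
    if "(x, y) \<in> {(v1, a), (a, b), (b, v3), (v2, c), (c, d), (d, v4), (a, c), (b, d)}" for x y
    using *[of x y] that by simp
qed (use continuous_push in simp_all)

text \<open>In \<open>C\<^sub>a\<close>, both maps lower \<open>v1\<close> by
  \<open>min (w v1) (mass_a w)\<close>. If this is all of \<open>w v1\<close>, then
  \<open>v1\<close> vanishes under both; otherwise \<open>w v1\<close> exceeds
  \<open>mass_a w\<close>, and \<open>a\<close> vanishes under both. This is why \<open>push\<close>
  is cut off at \<open>mass_a\<close>.\<close>

lemma expand_collapse_homotopic_push: "homotopic_with (\<lambda>_. True) (top_of_set X) (top_of_set X) (expand \<circ> collapse) push"
proof (rule X_homotopic)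
  show "continuous_map (top_of_set X) (top_of_set X) (expand \<circ> collapse)"
    using continuous_collapse continuous_expand by (rule continuous_map_compose)
  fix w assume "w \<in> topspace (top_of_set X)"
  then have w: "w \<in> X" by simp
  note nn = indep_weightsD(1)[OF w]
  note m = mass_nonneg[of w, OF nn]
  have collapse_nn: "0 \<le> collapse w v" for v using indep_weightsD(1)[OF collapse_mem[OF w]] .
  have old: "expand (collapse w) v = 0 \<and> push w v = 0" if "v \<in> V" "w v = 0" for v
    using push_zero[of w, OF nn that] expand_zero[of "collapse w", OF collapse_nn that(1) collapse_zero[of w, OF nn that]] by simp
  show "(expand \<circ> collapse) w x = 0 \<and> push w x = 0 \<or> (expand \<circ> collapse) w y = 0 \<and> push w y = 0"
    if "{x, y} \<in> E" "{x, y} \<noteq> {v1, v4}" "{x, y} \<noteq> {v2, v3}" "x \<noteq> y" for x y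
    using X_old_edge[OF w that(1,4)] that old E_V[OF that(1)] by auto
  have *: "expand (collapse w) x = 0 \<and> push w x = 0 \<or> expand (collapse w) y = 0 \<and> push w y = 0"
    if "(x, y) = (v1, a) \<or> (x, y) = (a, b) \<or> (x, y) = (b, v3) \<or> (x, y) = (v2, c) \<or>
        (x, y) = (c, d) \<or> (x, y) = (d, v4) \<or> (x, y) = (a, c) \<or> (x, y) = (b, d)" for x y
    using that
    by (elim disjE; cases rule: X_cases[OF w];
        use X_edge[OF w] nn[of v1] nn[of v2] nn[of v3] nn[of v4] m in \<open>auto simp: min_def\<close>)
  show "(expand \<circ> collapse) w x = 0 \<and> push w x = 0 \<or> (expand \<circ> collapse) w y = 0 \<and> push w y = 0"
    if "(x, y) \<in> {(v1, a), (a, b), (b, v3), (v2, c), (c, d), (d, v4), (a, c), (b, d)}" for x y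
    using *[of x y] that by simp
qed (use continuous_push in simp_all)

lemma homotopy_equivalent: "top_of_set X homotopy_equivalent_space top_of_set S"
  unfolding homotopy_equivalent_space_def
  using continuous_collapse continuous_expand collapse_expand_homotopic_id
    homotopic_with_trans[OF expand_collapse_homotopic_push push_homotopic_id] by blast

end

theorem theorem5p1:
  fixes V V' :: "'a set" and E E' :: "'a set set"
    and v1 v2 v3 v4 a b c d :: 'a
  assumes "finite_simple_graph V E"
    and "{v1, v2, v3, v4} \<subseteq> V" and "distinct [v1, v2, v3, v4]"
    and "{v1, v4} \<in> E" and "{v2, v3} \<in> E" and "{v1, v2} \<in> E"
    and "{a, b, c, d} \<inter> V = {}" and "distinct [a, b, c, d]"
    and "V' = V \<union> {a, b, c, d}"
    and "E' = (E - {{v1, v4}, {v2, v3}}) \<union>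
           {{v1, a}, {a, b}, {b, v3}, {v2, c}, {c, d}, {d, v4}, {a, c}, {b, d}}"
  shows "geometric_realization (independence_complex V' E') homotopy_equivalent_space
         suspension (geometric_realization (independence_complex V E))"
proof -
  interpret crossed_edges V E v1 v2 v3 v4 a b c d
    using assms by unfold_locales
  have "V' = H" "E' = EH" using assms by (auto simp: H_def EH_def)
  moreover have "suspension (top_of_set (indep_weights V E)) homeomorphic_space top_of_set S"
    using assms fin
    by (intro suspension_indep_weights) (auto simp: finite_simple_graph_def nsets_def)
  ultimately show ?thesis
    using homotopy_equivalent
    by (simp add: fin geometric_realization_independence_complex)
      (meson homeomorphic_imp_homotopy_equivalent_space homotopy_equivalent_space_sym
        homotopy_eqv_trans)
qed

end
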